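(* Let $R$ be a supertropical domain, let $A\in M_n(R)$ be a quasi-invertible matrix (i.e. $|A|$ is invertible in $R$), and let $v\in R^{(n)}$ be a tangible vector. Then the equation $Ax\models_{gs} v$ has the tangible vector solution $x=\widehat{(A^{\nabla}v)}$.
   Context: A semiring with ghosts is a triple $(R,\mathcal G_0,\nu)$ where $R$ is a semiring with zero $0_R$ and unit $1_R$, $\mathcal G_0=\mathcal G\cup\{0_R\}$ is a semiring ideal (the ghost ideal, whose elements are called ghost), and $\nu:R\to\mathcal G_0$, $\nu(a)=a+a$ (written $a^\nu$), is an idempotent semiring homomorphism. It is a supertropical semiring if $a+b=a^\nu$ whenever $a^\nu=b^\nu$, and $a+b\in\{a,b\}$ whenever $a^\nu\ne b^\nu$ (equivalently, $\mathcal G_0$ is totally ordered via $a^\nu\le b^\nu$ iff $a^\nu+b^\nu=b^\nu$). A supertropical domain is a commutative supertropical semiring such that $\mathcal T=R\setminus\mathcal G_0$ (the tangible elements) is a monoid under multiplication and $\nu|_{\mathcal T}:\mathcal T\to\mathcal G$ is onto. Put $\mathcal T_0=\mathcal T\cup\{0_R\}$. Write $b\models_{gs}a$ ("ghost surpasses") if $b=a+c$ for some $c\in\mathcal G_0$. For vectors in $R^{(n)}$ (the $n$-fold Cartesian product) the relation $\models_{gs}$ is taken componentwise. A nonzero vector is tangible if all its components lie in $\mathcal T_0$. A tangible retract function is fixed: a map $\hat\nu:R\to\mathcal T_0$, written $b\mapsto\hat b$, which is the identity on $\mathcal T_0$ and satisfies $(\hat b)^\nu=b$ for all $b\in\mathcal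 G_0$; it is applied componentwise to vectors. For $A=(a_{i,j})\in M_n(R)$, $|A|=\sum_{\sigma\in S_n}a_{1,\sigma(1)}\cdots a_{n,\sigma(n)}$ (the permanent), $A_{i,j}$ is obtained by deleting row $i$ and column $j$, and $\operatorname{adj}(A)$ has $(i,j)$ entry $|A_{j,i}|$ (the empty determinant is $1_R$). If $|A|$ is invertible, $A^{\nabla}=|A|^{-1}\operatorname{adj}(A)$. *)

theory Defs
  imports "Jordan_Normal_Form.Determinant"
begin

definition nu :: "'a::plus \<Rightarrow> 'a" where
  "nu a = a + a"

(* G0 is the ghost ideal, zero included. Since nu a = a + a, the triple (R, G0, nu) is determined
   by the type 'a (with R = UNIV) and the set G0. Preservation of the unit is not listed: the unit
   of the semiring nu ` R is nu 1, and in a supertropical domain nu ` R = G0. The class semiring_1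
   also demands 0 \<noteq> 1; for supertropical domains this follows from 1 being tangible and 0 ghost. *)
locale semiring_with_ghosts =
  fixes G0 :: "'a::semiring_1 set"
  assumes zero_ghost: "0 \<in> G0"
    and add_ghost: "a \<in> G0 \<Longrightarrow> b \<in> G0 \<Longrightarrow> a + b \<in> G0"
    and mult_ghost_left: "a \<in> G0 \<Longrightarrow> r * a \<in> G0"
    and mult_ghost_right: "a \<in> G0 \<Longrightarrow> a * r \<in> G0"
    and nu_ghost: "nu a \<in> G0"
    and nu_zero: "nu (0::'a) = 0"
    and nu_add: "nu (a + b) = nu a + nu (b::'a)"
    and nu_mult: "nu (a * b) = nu a * nu (b::'a)"
    and nu_idem: "nu (nu a) = nu (a::'a)"

locale supertropical_semiring = semiring_with_ghosts G0
  for G0 :: "'a::semiring_1 set" +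
  assumes add_eq_nu: "nu a = nu (b::'a) \<Longrightarrow> a + b = nu a"
    and add_bipotent: "nu a \<noteq> nu (b::'a) \<Longrightarrow> a + b \<in> {a, b}"

definition tangibles :: "'a set \<Rightarrow> 'a set" where
  "tangibles G0 = - G0"

definition tangibles0 :: "'a::zero set \<Rightarrow> 'a set" where
  "tangibles0 G0 = tangibles G0 \<union> {0}"

(* nu_onto: nu restricts to a map from the tangibles onto G = G0 - {0}; in particular
   nu a \<noteq> 0 for tangible a. *)
locale supertropical_domain = supertropical_semiring G0
  for G0 :: "'a::comm_semiring_1 set" +
  assumes one_tangible: "1 \<in> tangibles G0"
    and mult_tangible: "a \<in> tangibles G0 \<Longrightarrow> b \<in> tangibles G0 \<Longrightarrow> a * b \<in> tangibles G0"
    and nu_onto: "nu ` tangibles G0 = G0 - {0}"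

definition tangible_retract :: "'a::{plus,zero} set \<Rightarrow> ('a \<Rightarrow> 'a) \<Rightarrow> bool" where
  "tangible_retract G0 hat \<longleftrightarrow>
     (\<forall>b. hat b \<in> tangibles0 G0) \<and>
     (\<forall>b \<in> tangibles0 G0. hat b = b) \<and>
     (\<forall>b \<in> G0. nu (hat b) = b)"

definition ghost_surpasses :: "'a::plus set \<Rightarrow> 'a \<Rightarrow> 'a \<Rightarrow> bool" where
  "ghost_surpasses G0 b a \<longleftrightarrow> (\<exists>c \<in> G0. b = a + c)"

definition ghost_surpasses_vec :: "'a::plus set \<Rightarrow> 'a vec \<Rightarrow> 'a vec \<Rightarrow> bool" where
  "ghost_surpasses_vec G0 w v \<longleftrightarrow>
     dim_vec w = dim_vec v \<and> (\<forall>i < dim_vec v. ghost_surpasses G0 (w $ i) (v $ i))"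

definition tangible_vec :: "'a::zero set \<Rightarrow> 'a vec \<Rightarrow> bool" where
  "tangible_vec G0 v \<longleftrightarrow>
     v \<noteq> 0\<^sub>v (dim_vec v) \<and> (\<forall>i < dim_vec v. v $ i \<in> tangibles0 G0)"

(* The supertropical determinant |A| of a square matrix; the value on the 0 x 0 matrix is 1. *)
definition perm_det :: "'a::comm_semiring_1 mat \<Rightarrow> 'a" where
  "perm_det A = (\<Sum>p \<in> {p. p permutes {0..<dim_row A}}. \<Prod>i = 0..<dim_row A. A $$ (i, p i))"

definition perm_adj :: "'a::comm_semiring_1 mat \<Rightarrow> 'a mat" where
  "perm_adj A = mat (dim_row A) (dim_col A) (\<lambda>(i, j). perm_det (mat_delete A j i))"

definition quasi_invertible :: "'a::comm_semiring_1 mat \<Rightarrow> bool" where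
  "quasi_invertible A \<longleftrightarrow> (\<exists>b. perm_det A * b = 1)"

definition unit_inv :: "'a::comm_semiring_1 \<Rightarrow> 'a" where
  "unit_inv a = (THE b. a * b = 1)"

(* A^nabla = |A|^{-1} adj(A), meaningful when A is quasi-invertible *)
definition quasi_inverse :: "'a::comm_semiring_1 mat \<Rightarrow> 'a mat" where
  "quasi_inverse A = unit_inv (perm_det A) \<cdot>\<^sub>m perm_adj A"

end

theory Submission
  imports Defs
begin

text \<open>
  Compare elements by their ghost value, writing \<open>a \<preceq>\<^sub>\<nu> b\<close> for \<open>\<nu>(a) \<le> \<nu>(b)\<close>. The order is total and
  multiplication preserves \<open>\<preceq>\<^sub>\<nu>\<close>, but \<open>R\<close> need not be cancellative: \<open>a \<prec>\<^sub>\<nu> b\<close> does not give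
  \<open>c * a \<prec>\<^sub>\<nu> c * b\<close>. The proof therefore never multiplies a strict inequality.

  A sum is tangible only if one of its terms is tangible and strictly dominates all others, and then
  the sum equals that term. An invertible \<open>d = |A|\<close> is tangible, so exactly one permutation \<open>\<sigma>\<close>
  yields the dominant term of \<open>|A|\<close>. Write \<open>A\<^sub>i\<^sub>j\<close> for \<open>A\<close> without row \<open>i\<close> and column \<open>j\<close>. Expanding along row \<open>i\<close> gives \<open>a\<^sub>i\<^sub>j |A\<^sub>i\<^sub>j| \<preceq>\<^sub>\<nu> d\<close> for all \<open>j\<close>, with
  the exact equality \<open>a\<^sub>i\<^sub>j |A\<^sub>i\<^sub>j| = d\<close> for \<open>j = \<sigma>(i)\<close> (lemma \<open>dominant_expansion\<close>).
  If \<open>k \<noteq> i\<close>, the sum of the products \<open>a\<^sub>i\<^sub>j |A\<^sub>k\<^sub>j|\<close> over \<open>j\<close> expands a permanent with two equal rows;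
  exchanging these rows pairs its terms, so no \<open>j\<close> can be strictly dominant there
  (lemma \<open>repeated_row_not_dominant\<close>).

  Let \<open>y = A\<^sup>\<nabla> v\<close>; then \<open>x\<close> and \<open>y\<close> have the same ghost values. For \<open>l = \<sigma>(i)\<close> the product
  \<open>a\<^sub>i\<^sub>l y\<^sub>l\<close> contains the summand \<open>d\<^sup>-\<^sup>1 d v\<^sub>i = v\<^sub>i\<close>, so \<open>v\<^sub>i \<preceq>\<^sub>\<nu> (A x)\<^sub>i\<close>. This makes \<open>x\<close> nonzero,
  and it settles every row in which \<open>(A x)\<^sub>i\<close> is ghost. If \<open>(A x)\<^sub>i\<close> is tangible, a single product
  \<open>a\<^sub>i\<^sub>j x\<^sub>j\<close> strictly dominates the row. By the two facts above its value can only come from \<open>v\<^sub>i\<close>, which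
  forces \<open>j = \<sigma>(i)\<close> and \<open>a\<^sub>i\<^sub>j y\<^sub>j = v\<^sub>i\<close> exactly. Then \<open>y\<^sub>j\<close> is tangible, the retract does not change it,
  and \<open>(A x)\<^sub>i = v\<^sub>i\<close>.
\<close>

section \<open>The order by ghost values\<close>

definition nu_le :: "'a::plus \<Rightarrow> 'a \<Rightarrow> bool" (infix "\<preceq>\<^sub>\<nu>" 50) where
  "a \<preceq>\<^sub>\<nu> b \<longleftrightarrow> nu a + nu b = nu b"

definition nu_less :: "'a::plus \<Rightarrow> 'a \<Rightarrow> bool" (infix "\<prec>\<^sub>\<nu>" 50) where
  "a \<prec>\<^sub>\<nu> b \<longleftrightarrow> a \<preceq>\<^sub>\<nu> b \<and> nu a \<noteq> nu b"

context supertropical_semiring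
begin

lemma nu_add_self: "nu a + nu a = nu (a::'a)"
  using nu_idem[of a] by (simp add: nu_def)

lemma nu_le_trans: "a \<preceq>\<^sub>\<nu> b \<Longrightarrow> b \<preceq>\<^sub>\<nu> c \<Longrightarrow> a \<preceq>\<^sub>\<nu> (c::'a)"
  unfolding nu_le_def by (metis add.assoc)

lemma nu_le_antisym: "a \<preceq>\<^sub>\<nu> b \<Longrightarrow> b \<preceq>\<^sub>\<nu> a \<Longrightarrow> nu a = nu (b::'a)"
  unfolding nu_le_def by (metis add.commute)

lemma nu_le_eq: "nu a = nu b \<Longrightarrow> a \<preceq>\<^sub>\<nu> (b::'a)"
  unfolding nu_le_def using nu_add_self by metis

lemma nu_le_cases: "a \<prec>\<^sub>\<nu> b \<or> nu a = nu b \<or> b \<prec>\<^sub>\<nu> (a::'a)"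
  using add_bipotent[of "nu a" "nu b"]
  by (auto simp: nu_less_def nu_le_def nu_idem add.commute)

lemma nu_le_less_trans: "a \<preceq>\<^sub>\<nu> b \<Longrightarrow> b \<prec>\<^sub>\<nu> c \<Longrightarrow> a \<prec>\<^sub>\<nu> (c::'a)"
  unfolding nu_less_def by (metis nu_le_trans nu_le_antisym nu_le_eq)

lemma nu_less_le_trans: "a \<prec>\<^sub>\<nu> b \<Longrightarrow> b \<preceq>\<^sub>\<nu> c \<Longrightarrow> a \<prec>\<^sub>\<nu> (c::'a)"
  unfolding nu_less_def by (metis nu_le_trans nu_le_antisym nu_le_eq)

lemma nu_less_not_le: "a \<prec>\<^sub>\<nu> b \<Longrightarrow> \<not> b \<preceq>\<^sub>\<nu> (a::'a)"
  unfolding nu_less_def using nu_le_antisym by blast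

lemma nu_le_mult_left: "a \<preceq>\<^sub>\<nu> b \<Longrightarrow> c * a \<preceq>\<^sub>\<nu> c * (b::'a)"
  unfolding nu_le_def by (metis nu_mult distrib_left)

lemma nu_le_mult_right: "a \<preceq>\<^sub>\<nu> b \<Longrightarrow> a * c \<preceq>\<^sub>\<nu> b * (c::'a)"
  unfolding nu_le_def by (metis nu_mult distrib_right)

lemma nu_le_add: "a \<preceq>\<^sub>\<nu> a + (b::'a)"
  unfolding nu_le_def nu_add by (metis nu_add_self add.assoc)

lemma add_eq_dominant:
  assumes "a \<prec>\<^sub>\<nu> (b::'a)"
  shows "a + b = b"
  using add_bipotent[of a b] assms nu_add[of a b] by (auto simp: nu_less_def nu_le_def)

section \<open>Sums and their dominant terms\<close>

lemma nu_le_sum: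
  assumes "finite S" "k \<in> S"
  shows "f k \<preceq>\<^sub>\<nu> (\<Sum>l\<in>S. f l :: 'a)"
  using assms nu_le_add by (metis sum.remove)

lemma nu_sum_attained:
  assumes "finite S" "S \<noteq> {}"
  shows "\<exists>k\<in>S. nu (\<Sum>l\<in>S. f l :: 'a) = nu (f k)"
  using assms
proof (induction S rule: finite_ne_induct)
  case (insert a S)
  let ?s = "\<Sum>l\<in>S. f l"
  have "nu (f a + ?s) = nu (f a) \<or> nu (f a + ?s) = nu ?s"
    using add_eq_nu[of "f a" ?s] add_bipotent[of "f a" ?s] nu_idem[of "f a"]
    by (cases "nu (f a) = nu ?s") auto
  then show ?case using insert by auto
qed simp

lemma tangible_sum_dominant:
  assumes "finite S" "(\<Sum>l\<in>S. f l) \<notin> G0"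
  obtains k where "k \<in> S" "(\<Sum>l\<in>S. f l) = f k" "\<And>l. l \<in> S \<Longrightarrow> l \<noteq> k \<Longrightarrow> f l \<prec>\<^sub>\<nu> f k"
proof -
  have "\<exists>k\<in>S. (\<Sum>l\<in>S. f l) = f k \<and> (\<forall>l\<in>S. l \<noteq> k \<longrightarrow> f l \<prec>\<^sub>\<nu> f k)"
    using assms
  proof (induction S rule: finite_induct)
    case empty
    then show ?case using zero_ghost by simp
  next
    case (insert a S)
    let ?s = "\<Sum>l\<in>S. f l"
    have sum: "(\<Sum>l\<in>insert a S. f l) = f a + ?s" using insert by simp
    have "nu (f a) \<noteq> nu ?s"
      using insert.prems sum add_eq_nu nu_ghost by metis
    then consider "f a \<prec>\<^sub>\<nu> ?s" | "?s \<prec>\<^sub>\<nu> f a" using nu_le_cases by blast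
    then show ?case
    proof cases
      case 1
      then have s: "f a + ?s = ?s" by (rule add_eq_dominant)
      then obtain k where "k \<in> S" "?s = f k" "\<forall>l\<in>S. l \<noteq> k \<longrightarrow> f l \<prec>\<^sub>\<nu> f k"
        using insert sum by auto
      then show ?thesis using 1 s sum by auto
    next
      case 2
      then have "f a + ?s = f a" using add_eq_dominant add.commute by metis
      moreover have "f l \<prec>\<^sub>\<nu> f a" if "l \<in> S" for l
        using nu_le_less_trans[OF nu_le_sum[OF insert.hyps(1) that] 2] .
      ultimately show ?thesis using sum by auto
    qed
  qed
  then show ?thesis using that by blast
qed

lemma sum_eq_dominant:
  assumes "finite S" "k \<in> S" "\<And>l. l \<in> S \<Longrightarrow> l \<noteq> k \<Longrightarrow> f l \<prec>\<^sub>\<nu> (f k :: 'a)"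
  shows "(\<Sum>l\<in>S. f l) = f k"
proof (cases "S - {k} = {}")
  case True
  show ?thesis using sum.remove[OF assms(1,2), of f] unfolding True by simp
next
  case False
  then obtain l where l: "l \<in> S - {k}" "nu (\<Sum>l\<in>S - {k}. f l) = nu (f l)"
    using nu_sum_attained[of "S - {k}" f] assms(1) by auto
  then have "(\<Sum>l\<in>S - {k}. f l) \<prec>\<^sub>\<nu> f k"
    using assms(3)[of l] nu_le_less_trans[OF nu_le_eq] by auto
  then show ?thesis
    using add_eq_dominant assms(1,2) sum.remove[of S k f] by (metis add.commute)
qed

text \<open>A ghost element surpasses everything below it, since \<open>v + g = g\<close> whenever \<open>g\<close> is ghost,
  fixed by \<open>\<nu>\<close>, and at least \<open>v\<close>.\<close>

lemma ghost_surpasses_below_ghost: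
  assumes "g \<in> G0" "nu g = g" "v \<preceq>\<^sub>\<nu> g"
  shows "ghost_surpasses G0 g v"
proof -
  have "v + g = g"
    using assms add_eq_nu[of v g] add_eq_dominant[of v g] by (auto simp: nu_less_def)
  then show ?thesis using assms(1) unfolding ghost_surpasses_def by metis
qed

end

section \<open>Minors as sums over permutations\<close>

lemma perm_det_mat_delete:
  fixes A :: "'a::comm_semiring_1 mat"
  assumes A: "A \<in> carrier_mat n n" and k: "k < n" and j: "j < n"
  shows "perm_det (mat_delete A k j) =
    (\<Sum>p \<in> {p. p permutes {0..<n} \<and> p k = j}. \<Prod>r \<in> {0..<n} - {k}. A $$ (r, p r))"
proof -
  obtain m where n: "n = Suc m" using k by (cases n) auto
  have dim: "dim_row (mat_delete A k j) = m" using A n by simp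
  have ins: "permutation_insert k j q (insert_index k x) = insert_index j (q x)" for q x
    by (simp add: permutation_insert_expand insert_index_def)
  have "(\<Prod>r \<in> {0..<n} - {k}. A $$ (r, permutation_insert k j q r)) =
      (\<Prod>x = 0..<m. mat_delete A k j $$ (x, q x))" if q: "q permutes {0..<m}" for q
  proof -
    have "{0..<n} - {k} = insert_index k ` {0..<m}"
      using insert_index_image[of k m] k n by simp
    then have "(\<Prod>r \<in> {0..<n} - {k}. A $$ (r, permutation_insert k j q r)) =
        (\<Prod>x = 0..<m. A $$ (insert_index k x, insert_index j (q x)))"
      by (simp add: prod.reindex insert_index_inj_on ins)
    also have "\<dots> = (\<Prod>x = 0..<m. mat_delete A k j $$ (x, q x))"
    proof (rule prod.cong[OF refl])
      fix x assume x: "x \<in> {0..<m}"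
      then have "q x < m" using q permutes_in_image[of q "{0..<m}" x] by auto
      then show "A $$ (insert_index k x, insert_index j (q x)) = mat_delete A k j $$ (x, q x)"
        using mat_delete_index[of A m k j x "q x"] A k j x n by auto
    qed
    finally show ?thesis .
  qed
  then show ?thesis
    using k j permutation_fix[of k m j] permutation_insert_inj_on[of k m j]
    by (simp add: perm_det_def dim[simplified] n sum.reindex)
qed

lemma row_entry_mult_minor:
  fixes A :: "'a::comm_semiring_1 mat"
  assumes "A \<in> carrier_mat n n" "i < n" "j < n"
  shows "A $$ (i, j) * perm_det (mat_delete A i j) =
    (\<Sum>p \<in> {p. p permutes {0..<n} \<and> p i = j}. \<Prod>r = 0..<n. A $$ (r, p r))"
  unfolding perm_det_mat_delete[OF assms] sum_distrib_left
proof (rule sum.cong[OF refl])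
  fix p assume "p \<in> {p. p permutes {0..<n} \<and> p i = j}"
  then show "A $$ (i, j) * (\<Prod>r \<in> {0..<n} - {i}. A $$ (r, p r)) = (\<Prod>r = 0..<n. A $$ (r, p r))"
    using assms(2) prod.remove[of "{0..<n}" i "\<lambda>r. A $$ (r, p r)"] by auto
qed

lemma ex_permutes_value:
  assumes "k \<in> S" "j \<in> S"
  shows "\<exists>p. p permutes S \<and> p k = j"
  using assms permutes_swap_id[of k S j] by (intro exI[of _ "transpose k j"]) auto

section \<open>Row expansions of a permanent\<close>

context supertropical_domain
begin

text \<open>A permutation attaining the ghost value of \<open>|A\<^sub>k\<^sub>j|\<close> sends \<open>k\<close> to \<open>j\<close> and \<open>i\<close> to some \<open>l \<noteq> j\<close>.
  Composing it with the transposition of \<open>i\<close> and \<open>k\<close> exchanges the roles of the two copies of row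
  \<open>i\<close>, and gives the same product as a term of \<open>a\<^sub>i\<^sub>l |A\<^sub>k\<^sub>l|\<close>.\<close>

lemma repeated_row_not_dominant:
  fixes A :: "'a mat"
  assumes A: "A \<in> carrier_mat n n" and i: "i < n" and k: "k < n" and ik: "i \<noteq> k" and j: "j < n"
  obtains l where "l < n" "l \<noteq> j"
    "A $$ (i, j) * perm_det (mat_delete A k j) \<preceq>\<^sub>\<nu> A $$ (i, l) * perm_det (mat_delete A k l)"
proof -
  let ?P = "\<lambda>j. {p. p permutes {0..<n} \<and> p k = j}"
  let ?M = "\<lambda>p. \<Prod>r \<in> {0..<n} - {k}. A $$ (r, p r)"
  have fin: "finite (?P j)" for j by (simp add: finite_permutations)
  have "?P j \<noteq> {}" using ex_permutes_value[of k "{0..<n}" j] j k by auto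
  then obtain p where p: "p permutes {0..<n}" "p k = j"
    and att: "nu (perm_det (mat_delete A k j)) = nu (?M p)"
    using nu_sum_attained[OF fin, of j ?M] perm_det_mat_delete[OF A k j] by auto
  define l where "l = p i"
  define q where "q = p \<circ> transpose i k"
  have l: "l < n" using permutes_in_image[OF p(1), of i] i by (simp add: l_def)
  have lj: "l \<noteq> j" using permutes_inj[OF p(1)] p(2) ik by (auto simp: l_def inj_def)
  have q: "q \<in> ?P l"
    using permutes_compose[OF permutes_swap_id[of i "{0..<n}" k] p(1)] i k
    by (auto simp: q_def l_def)
  have split: "?M f = A $$ (i, f i) * (\<Prod>r \<in> {0..<n} - {k} - {i}. A $$ (r, f r))" for f
    using prod.remove[of "{0..<n} - {k}" i "\<lambda>r. A $$ (r, f r)"] i ik by auto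
  have "(\<Prod>r \<in> {0..<n} - {k} - {i}. A $$ (r, q r)) = (\<Prod>r \<in> {0..<n} - {k} - {i}. A $$ (r, p r))"
    by (rule prod.cong) (auto simp: q_def transpose_def)
  moreover have "q i = j" using p(2) by (simp add: q_def)
  ultimately have eq: "A $$ (i, j) * ?M p = A $$ (i, l) * ?M q"
    by (simp add: split l_def mult.left_commute)
  have "A $$ (i, j) * perm_det (mat_delete A k j) \<preceq>\<^sub>\<nu> A $$ (i, j) * ?M p"
    using att by (intro nu_le_mult_left nu_le_eq)
  also note eq
  finally have "A $$ (i, j) * perm_det (mat_delete A k j) \<preceq>\<^sub>\<nu> A $$ (i, l) * ?M q" .
  moreover have "?M q \<preceq>\<^sub>\<nu> perm_det (mat_delete A k l)"
    unfolding perm_det_mat_delete[OF A k l] using nu_le_sum[OF fin q, of ?M] .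
  ultimately show ?thesis
    using that[OF l lj] nu_le_trans nu_le_mult_left by blast
qed

text \<open>The product \<open>a\<^sub>i\<^sub>j |A\<^sub>i\<^sub>j|\<close> is a partial sum of \<open>|A|\<close>. For \<open>j = \<sigma>(i)\<close> it contains the strictly
  dominant term and hence equals \<open>|A|\<close> on the nose. This equality needs the other terms to be
  dominated before anything is multiplied by \<open>|A|\<^sup>-\<^sup>1 v\<^sub>i\<close>, because strictness may be lost then.\<close>

lemma dominant_expansion:
  fixes A :: "'a mat"
  assumes A: "A \<in> carrier_mat n n" and d: "perm_det A \<notin> G0"
  obtains \<sigma> where "\<sigma> permutes {0..<n}"
    "\<And>i. i < n \<Longrightarrow> A $$ (i, \<sigma> i) * perm_det (mat_delete A i (\<sigma> i)) = perm_det A"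
    "\<And>i j. i < n \<Longrightarrow> j < n \<Longrightarrow> A $$ (i, j) * perm_det (mat_delete A i j) \<preceq>\<^sub>\<nu> perm_det A"
proof -
  let ?s = "\<lambda>p. \<Prod>r = 0..<n. A $$ (r, p r)"
  let ?P = "{p. p permutes {0..<n}}"
  have det: "perm_det A = (\<Sum>p\<in>?P. ?s p)" using A by (simp add: perm_det_def)
  have fin: "finite ?P" by (simp add: finite_permutations)
  obtain \<sigma> where \<sigma>: "\<sigma> \<in> ?P" "perm_det A = ?s \<sigma>"
    and dom: "\<And>p. p \<in> ?P \<Longrightarrow> p \<noteq> \<sigma> \<Longrightarrow> ?s p \<prec>\<^sub>\<nu> ?s \<sigma>"
    using tangible_sum_dominant[OF fin d[unfolded det], folded det] by blast
  let ?Q = "\<lambda>i j. {p. p permutes {0..<n} \<and> p i = j}"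
  have finQ: "finite (?Q i j)" for i j by (simp add: finite_permutations)
  have exact: "A $$ (i, \<sigma> i) * perm_det (mat_delete A i (\<sigma> i)) = perm_det A" if i: "i < n" for i
  proof -
    have si: "\<sigma> i < n" using \<sigma>(1) permutes_in_image[of \<sigma> "{0..<n}" i] i by simp
    have "(\<Sum>p\<in>?Q i (\<sigma> i). ?s p) = ?s \<sigma>"
      by (rule sum_eq_dominant[OF finQ]) (use \<sigma>(1) dom in auto)
    then show ?thesis using row_entry_mult_minor[OF A i si] \<sigma>(2) by simp
  qed
  have bound: "A $$ (i, j) * perm_det (mat_delete A i j) \<preceq>\<^sub>\<nu> perm_det A"
    if i: "i < n" and j: "j < n" for i j
  proof -
    have "?Q i j \<noteq> {}" using ex_permutes_value[of i "{0..<n}" j] i j by auto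
    then obtain p where "p permutes {0..<n}" "nu (\<Sum>p\<in>?Q i j. ?s p) = nu (?s p)"
      using nu_sum_attained[OF finQ, of i j ?s] by auto
    then show ?thesis
      using nu_le_trans[OF nu_le_eq nu_le_sum[OF fin, of p ?s]]
      unfolding row_entry_mult_minor[OF A i j] det by auto
  qed
  show ?thesis using that \<sigma>(1) exact bound by blast
qed

section \<open>Invertibility and the tangible retract\<close>

lemma nu_ghost_fixed: "g \<in> G0 \<Longrightarrow> nu g = g"
proof (cases "g = 0")
  case False
  assume "g \<in> G0"
  then obtain t where "g = nu t" using nu_onto False by (metis DiffI imageE singletonD)
  then show ?thesis using nu_idem by simp
qed (simp add: nu_zero)

lemma nu_eq_zero_iff: "nu a = 0 \<longleftrightarrow> a = (0::'a)"
  using nu_ghost_fixed[of a] nu_onto nu_zero by (cases "a \<in> G0") (auto simp: tangibles_def)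

lemma nu_le_zero: "a \<preceq>\<^sub>\<nu> (0::'a) \<longleftrightarrow> a = 0"
  unfolding nu_le_def by (simp add: nu_zero nu_eq_zero_iff)

lemma invertible_not_ghost: "a * b = 1 \<Longrightarrow> a \<notin> G0"
  using mult_ghost_right[of a b] one_tangible by (auto simp: tangibles_def)

lemma nu_retract: "tangible_retract G0 hat \<Longrightarrow> nu (hat b) = nu b"
  using nu_ghost_fixed[of b]
  by (cases "b \<in> G0") (auto simp: tangible_retract_def tangibles0_def tangibles_def)

end

lemma mult_unit_inv:
  fixes a :: "'a::comm_semiring_1"
  assumes "a * b = 1"
  shows "a * unit_inv a = 1"
  unfolding unit_inv_def
proof (rule theI)
  fix c assume "a * c = 1"
  then show "c = b" using assms by (metis mult.assoc mult.commute mult_1)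
qed (rule assms)

lemma quasi_inverse_mult_vec_index:
  fixes A :: "'a::comm_semiring_1 mat"
  assumes "A \<in> carrier_mat n n" "v \<in> carrier_vec n" "j < n"
  shows "(quasi_inverse A *\<^sub>v v) $ j =
    (\<Sum>k = 0..<n. unit_inv (perm_det A) * perm_det (mat_delete A k j) * v $ k)"
  using assms by (simp add: quasi_inverse_def perm_adj_def scalar_prod_def)

section \<open>Solving the system\<close>

context supertropical_domain
begin

context
  fixes A :: "'a mat" and v y :: "'a vec" and n :: nat
  assumes A: "A \<in> carrier_mat n n" and v: "v \<in> carrier_vec n"
    and inv: "perm_det A * unit_inv (perm_det A) = 1"
    and y: "y = quasi_inverse A *\<^sub>v v"
begin

text \<open>The summand of \<open>a\<^sub>i\<^sub>j y\<^sub>j\<close> that carries \<open>v\<^sub>k\<close>.\<close>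

definition row_term :: "nat \<Rightarrow> nat \<Rightarrow> nat \<Rightarrow> 'a" where
  "row_term i j k =
    unit_inv (perm_det A) * (A $$ (i, j) * perm_det (mat_delete A k j)) * v $ k"

lemma entry_mult_solution:
  "j < n \<Longrightarrow> A $$ (i, j) * y $ j = (\<Sum>k = 0..<n. row_term i j k)"
  using quasi_inverse_mult_vec_index[OF A v]
  by (simp add: y row_term_def sum_distrib_left mult_ac)

lemma row_term_le: "j < n \<Longrightarrow> k < n \<Longrightarrow> row_term i j k \<preceq>\<^sub>\<nu> A $$ (i, j) * y $ j"
  using entry_mult_solution nu_le_sum[of "{0..<n}" k "row_term i j"] by simp

lemma dominant_column:
  obtains \<sigma> where "\<sigma> permutes {0..<n}"
    "\<And>i. i < n \<Longrightarrow> row_term i (\<sigma> i) i = v $ i"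
    "\<And>i j. i < n \<Longrightarrow> j < n \<Longrightarrow> row_term i j i \<preceq>\<^sub>\<nu> v $ i"
proof -
  obtain \<sigma> where "\<sigma> permutes {0..<n}"
    and exact: "\<And>i. i < n \<Longrightarrow> A $$ (i, \<sigma> i) * perm_det (mat_delete A i (\<sigma> i)) = perm_det A"
    and bound: "\<And>i j. i < n \<Longrightarrow> j < n \<Longrightarrow>
      A $$ (i, j) * perm_det (mat_delete A i j) \<preceq>\<^sub>\<nu> perm_det A"
    using dominant_expansion[OF A invertible_not_ghost[OF inv]] by blast
  have cancel: "unit_inv (perm_det A) * perm_det A * c = c" for c
    using inv by (simp add: mult.commute)
  show ?thesis
  proof (rule that[OF \<open>\<sigma> permutes {0..<n}\<close>])
    show "row_term i (\<sigma> i) i = v $ i" if "i < n" for i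
      using exact[OF that] cancel by (simp add: row_term_def)
    show "row_term i j i \<preceq>\<^sub>\<nu> v $ i" if "i < n" "j < n" for i j
      using nu_le_mult_right[OF nu_le_mult_left[OF bound[OF that]],
          of "unit_inv (perm_det A)" "v $ i"]
      by (simp add: row_term_def cancel)
  qed
qed

text \<open>In a strictly dominant product the summands with \<open>k \<noteq> i\<close> are strictly dominated by the product
  itself, because each of them reappears, at least as large, in another column.\<close>

lemma strictly_dominant_product:
  assumes i: "i < n" and j: "j < n"
    and dom: "\<And>l. l < n \<Longrightarrow> l \<noteq> j \<Longrightarrow> A $$ (i, l) * y $ l \<prec>\<^sub>\<nu> A $$ (i, j) * y $ j"
  shows "A $$ (i, j) * y $ j = v $ i"
proof -
  let ?u = "\<lambda>j. A $$ (i, j) * y $ j"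
  have small: "row_term i j k \<prec>\<^sub>\<nu> ?u j" if k: "k < n" "k \<noteq> i" for k
  proof -
    obtain l where l: "l < n" "l \<noteq> j"
      and le: "A $$ (i, j) * perm_det (mat_delete A k j) \<preceq>\<^sub>\<nu> A $$ (i, l) * perm_det (mat_delete A k l)"
      using repeated_row_not_dominant[OF A i k(1) k(2)[symmetric] j] by blast
    have "row_term i j k \<preceq>\<^sub>\<nu> row_term i l k"
      unfolding row_term_def by (intro nu_le_mult_right nu_le_mult_left le)
    then show ?thesis
      using nu_le_trans row_term_le l(1) k(1) dom[OF l] nu_le_less_trans by blast
  qed
  have att: "nu (?u j) = nu (row_term i j i)"
  proof -
    obtain k where "k < n" "nu (?u j) = nu (row_term i j k)"
      using nu_sum_attained[of "{0..<n}" "row_term i j"] entry_mult_solution[OF j] i by auto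
    then show ?thesis using small[of k] by (cases "k = i") (auto simp: nu_less_def)
  qed
  have sum: "?u j = row_term i j i"
    unfolding entry_mult_solution[OF j]
  proof (rule sum_eq_dominant)
    fix k assume "k \<in> {0..<n}" "k \<noteq> i"
    then show "row_term i j k \<prec>\<^sub>\<nu> row_term i j i"
      using nu_less_le_trans[OF small nu_le_eq[OF att]] by simp
  qed (use i in auto)
  obtain \<sigma> where \<sigma>: "\<sigma> permutes {0..<n}" "row_term i (\<sigma> i) i = v $ i"
    and bound: "row_term i j i \<preceq>\<^sub>\<nu> v $ i"
    using dominant_column i j by metis
  have si: "\<sigma> i < n" using permutes_in_image[OF \<sigma>(1), of i] i by simp
  have "?u j \<preceq>\<^sub>\<nu> ?u (\<sigma> i)"
    using nu_le_trans[OF bound] row_term_le[OF si i] \<sigma>(2) sum by metis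
  then have "\<sigma> i = j" using dom[OF si] nu_less_not_le by blast
  then show ?thesis using sum \<sigma>(2) by simp
qed

text \<open>The retract changes \<open>y\<^sub>j\<close> only if \<open>y\<^sub>j\<close> is ghost. In a row with tangible value the one product that
  counts has \<open>a\<^sub>i\<^sub>j y\<^sub>j = v\<^sub>i\<close> tangible, so there \<open>y\<^sub>j\<close> is left alone; in a row with ghost value only the
  size of the value matters, and the retract preserves it.\<close>

lemma retract_solves:
  assumes hat: "tangible_retract G0 hat" and tan: "\<And>i. i < n \<Longrightarrow> v $ i \<in> tangibles0 G0"
    and i: "i < n"
  shows "v $ i \<preceq>\<^sub>\<nu> (A *\<^sub>v map_vec hat y) $ i"
    and "ghost_surpasses G0 ((A *\<^sub>v map_vec hat y) $ i) (v $ i)"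
proof -
  let ?w = "(A *\<^sub>v map_vec hat y) $ i"
  let ?u = "\<lambda>j. A $$ (i, j) * y $ j"
  let ?x = "\<lambda>j. A $$ (i, j) * hat (y $ j)"
  have dim: "dim_vec y = n" using A by (simp add: y quasi_inverse_def perm_adj_def)
  have w: "?w = (\<Sum>j = 0..<n. ?x j)" using A i dim by (simp add: scalar_prod_def)
  have nu_x: "nu (?x j) = nu (?u j)" for j
    using nu_retract[OF hat] by (simp add: nu_mult)
  obtain \<sigma> where \<sigma>: "\<sigma> permutes {0..<n}" "row_term i (\<sigma> i) i = v $ i"
    using dominant_column i by metis
  have si: "\<sigma> i < n" using permutes_in_image[OF \<sigma>(1), of i] i by simp
  have "v $ i \<preceq>\<^sub>\<nu> ?u (\<sigma> i)" using row_term_le[OF si i] \<sigma>(2) by metis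
  then have "v $ i \<preceq>\<^sub>\<nu> ?x (\<sigma> i)" using nu_le_trans nu_le_eq[OF nu_x[symmetric]] by blast
  then show le: "v $ i \<preceq>\<^sub>\<nu> ?w"
    unfolding w by (rule nu_le_trans) (rule nu_le_sum, use si in auto)
  show "ghost_surpasses G0 ?w (v $ i)"
  proof (cases "?w \<in> G0")
    case True
    then show ?thesis using ghost_surpasses_below_ghost nu_ghost_fixed le by blast
  next
    case False
    then obtain j where j: "j < n" "?w = ?x j"
      and dom: "\<And>l. l < n \<Longrightarrow> l \<noteq> j \<Longrightarrow> ?x l \<prec>\<^sub>\<nu> ?x j"
      using tangible_sum_dominant[of "{0..<n}" ?x] unfolding w by auto
    have "?u l \<prec>\<^sub>\<nu> ?u j" if "l < n" "l \<noteq> j" for l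
      using dom[OF that] nu_x by (simp add: nu_less_def nu_le_def)
    then have eq: "?u j = v $ i" using strictly_dominant_product[OF i j(1)] by blast
    have "v $ i \<noteq> 0"
      using False eq j(2) nu_x[of j] nu_zero nu_eq_zero_iff zero_ghost by metis
    then have "v $ i \<notin> G0" using tan[OF i] by (auto simp: tangibles0_def tangibles_def)
    then have "y $ j \<notin> G0" using eq mult_ghost_left by metis
    then have "hat (y $ j) = y $ j"
      using hat by (auto simp: tangible_retract_def tangibles0_def tangibles_def)
    then have "?w = v $ i + 0" using eq j(2) by simp
    then show ?thesis unfolding ghost_surpasses_def using zero_ghost by blast
  qed
qed

end

end

theorem theorem3p5:
  fixes G0 :: "'a::comm_semiring_1 set"
    and hat :: "'a \<Rightarrow> 'a"
    and n :: nat
    and A :: "'a mat"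
    and v x :: "'a vec"
  assumes "supertropical_domain G0"
    and "tangible_retract G0 hat"
    and "A \<in> carrier_mat n n"
    and "quasi_invertible A"
    and "v \<in> carrier_vec n"
    and "tangible_vec G0 v"
    and "x = map_vec hat (quasi_inverse A *\<^sub>v v)"
  shows "x \<in> carrier_vec n \<and> tangible_vec G0 x \<and> ghost_surpasses_vec G0 (A *\<^sub>v x) v"
proof -
  interpret supertropical_domain G0 by fact
  have inv: "perm_det A * unit_inv (perm_det A) = 1"
    using assms(4) by (auto simp: quasi_invertible_def intro: mult_unit_inv)
  have tan: "v $ i \<in> tangibles0 G0" if "i < n" for i
    using that assms(5,6) by (simp add: tangible_vec_def)
  have solves: "v $ i \<preceq>\<^sub>\<nu> (A *\<^sub>v x) $ i" "ghost_surpasses G0 ((A *\<^sub>v x) $ i) (v $ i)" if "i < n" for i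
    using retract_solves[OF assms(3,5) inv refl assms(2) tan that] unfolding assms(7) by blast+
  have x: "x \<in> carrier_vec n"
    unfolding assms(7) using assms(3)
    by (intro carrier_vecI) (simp add: quasi_inverse_def perm_adj_def)
  have "x \<noteq> 0\<^sub>v n"
  proof
    assume zero: "x = 0\<^sub>v n"
    have "v $ i = 0" if i: "i < n" for i
    proof -
      have "(A *\<^sub>v x) $ i = 0" using zero i assms(3) by (simp add: scalar_prod_def)
      then show ?thesis using solves(1)[OF i] nu_le_zero by simp
    qed
    then have "v = 0\<^sub>v n" using assms(5) by auto
    then show False using assms(5,6) by (simp add: tangible_vec_def)
  qed
  moreover have "x $ i \<in> tangibles0 G0" if "i < n" for i
  proof -
    have "i < dim_vec (quasi_inverse A *\<^sub>v v)" using that carrier_vecD[OF x] by (simp add: assms(7))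
    then show ?thesis using assms(2) by (simp add: assms(7) tangible_retract_def)
  qed
  ultimately have "tangible_vec G0 x" using x by (simp add: tangible_vec_def)
  moreover have "ghost_surpasses_vec G0 (A *\<^sub>v x) v"
    using solves(2) assms(3,5) by (auto simp: ghost_surpasses_vec_def)
  ultimately show ?thesis using x by blast
qed

end
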